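(* Let $G$ be a graph with an anchor $H=G\setminus\{v,w\}$, where $v,w$ are two distinct vertices of $G$. If the distance of $v$ and $w$ within $H$ specifies the state of placing both of the neighborhoods of $v$ and $w$ together in $H$, then $G$ is reconstructible.
   Context: All graphs are finite and simple; subgraphs are vertex-induced. An anchor of $G$ is a proper nonempty induced subgraph $H$ that occurs exactly once in $G$: no vertex set $W\neq V(H)$ satisfies $G[W]\cong H$. The deck of $G$ is the multiset of isomorphism classes of the graphs $G\setminus x$, $x\in V(G)$; $G$ is reconstructible if every graph with the same deck as $G$ is isomorphic to $G$. Let $s_v=N(v)\cap V(H)$ and $s_w=N(w)\cap V(H)$. For subsets $S,T\subseteq V(H)$, let $d_H(S,T)$ be the length of a shortest path between $x$ and $y$ in the graph obtained from $H$ by adding two new non-adjacent vertices $x,y$ with neighborhoods $S$ and $T$ respectively ($d_H(S,T)=\infty$ if there is no such path). The distance of $v$ and $w$ within $H$ is $d_H(s_v,s_w)$ (so a possible edge $vw$ of $G$ is ignored). The distance of $v$ and $w$ within $H$ "specifies the state of placing both of the neighborhoods of $v$ and $w$ together in $H$" means: for all $\alpha,\beta\in\mathrm{Aut}(H)$, if $d_H(\alpha(s_v),\beta(s_w))=d_H(s_v,s_w)$, then there is $\gamma\in\mathrm{Aut}(H)$ such that the multisets $\{\gamma(s_v),\gamma(s_w)\}$ and $\{\alpha(s_v),\beta(s_w)\}$ are equal. *)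

theory Defs
  imports "Graph_Theory.Graph_Theory" "HOL-Library.Multiset"
begin

text \<open>
  Finite simple graphs are digraphs satisfying the locale predicate \<open>graph\<close>: finite, loop-free,
  without parallel arcs and with a symmetric arc relation, every edge being a pair of opposite arcs.
\<close>

section \<open>Decks and reconstructibility\<close>

text \<open>
  Isomorphism classes are represented by their members with vertices in \<^typ>\<open>nat\<close>, so that classes
  of graphs over different vertex types can be compared. As every finite graph has a copy on natural
  numbers, two finite simple graphs have equal classes iff they are isomorphic
  (\<open>iso_class_eq_iff\<close>), and quantifying over competitors with vertices in \<^typ>\<open>nat\<close> in
  \<open>reconstructible\<close> covers competitors over every vertex type (\<open>reconstructibleD\<close>).
\<close>

definition iso_class :: "('a, 'b) pre_digraph \<Rightarrow> nat pair_pre_digraph set" where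
  "iso_class K = {L. digraph_iso K (with_proj L)}"

definition deck :: "('a, 'b) pre_digraph \<Rightarrow> nat pair_pre_digraph set multiset" where
  "deck G = image_mset (\<lambda>x. iso_class (pre_digraph.del_vert G x)) (mset_set (verts G))"

definition reconstructible :: "('a, 'b) pre_digraph \<Rightarrow> bool" where
  "reconstructible G \<longleftrightarrow>
     (\<forall>K :: nat pair_pre_digraph.
        graph (with_proj K) \<and> deck (with_proj K) = deck G \<longrightarrow> digraph_iso (with_proj K) G)"

lemma iso_class_nonempty:
  assumes "graph K"
  shows "\<exists>L. L \<in> iso_class K"
proof -
  interpret graph K by fact
  obtain f :: "'a \<Rightarrow> nat" where f: "inj_on f (verts K)"
    using finite_imp_inj_to_nat_seg[OF finite_verts] by blast
  let ?a = "\<lambda>e. (f (tail K e), f (head K e))"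
  let ?h = "\<lparr>iso_verts = f, iso_arcs = ?a, iso_head = snd, iso_tail = fst\<rparr>"
  let ?L = "\<lparr>pverts = f ` verts K, parcs = ?a ` arcs K\<rparr>"
  have "inj_on ?a (arcs K)"
    by (rule inj_onI) (auto simp: arc_to_ends_def inj_on_eq_iff[OF f] intro!: no_multi_arcs)
  then have "pre_digraph.digraph_isomorphism K ?h"
    using f unfolding pre_digraph.digraph_isomorphism_def by (simp add: wf_digraph)
  moreover have "with_proj ?L = app_iso ?h K"
    by (simp add: with_proj_def app_iso_def)
  ultimately have "?L \<in> iso_class K"
    unfolding iso_class_def digraph_iso_def by blast
  then show ?thesis ..
qed

lemma iso_class_eqI:
  assumes "wf_digraph K" and "digraph_iso K L"
  shows "iso_class K = iso_class L"
  unfolding iso_class_def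
  by (auto intro: digraph_iso_trans[OF assms(2)] digraph_iso_trans[OF digraph_iso_swap[OF assms]])

lemma iso_class_eq_iff:
  assumes "graph K" and "graph L"
  shows "iso_class K = iso_class L \<longleftrightarrow> digraph_iso K L"
proof
  assume "iso_class K = iso_class L"
  with iso_class_nonempty[OF assms(1)] obtain M :: "nat pair_pre_digraph"
    where KM: "digraph_iso K (with_proj M)" and LM: "digraph_iso L (with_proj M)"
    unfolding iso_class_def by auto
  have "wf_digraph L"
    using assms(2) by (simp add: graph_def digraph_def fin_digraph_def)
  from digraph_iso_trans[OF KM digraph_iso_swap[OF this LM]] show "digraph_iso K L" .
next
  assume "digraph_iso K L"
  with assms(1) show "iso_class K = iso_class L"
    by (intro iso_class_eqI) (simp_all add: graph_def digraph_def fin_digraph_def)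
qed

lemma del_vert_iso:
  assumes "pre_digraph.digraph_isomorphism G h" and "x \<in> verts G"
  shows "digraph_iso (pre_digraph.del_vert G x) (pre_digraph.del_vert (app_iso h G) (iso_verts h x))"
proof -
  interpret wf_digraph G
    using assms(1) by (simp add: pre_digraph.digraph_isomorphism_def)
  have inj: "inj_on (iso_verts h) (verts G)" "inj_on (iso_arcs h) (arcs G)"
    and ends: "\<And>a. a \<in> arcs G \<Longrightarrow> iso_tail h (iso_arcs h a) = iso_verts h (tail G a)"
      "\<And>a. a \<in> arcs G \<Longrightarrow> iso_head h (iso_arcs h a) = iso_verts h (head G a)"
    using assms(1) by (auto simp: pre_digraph.digraph_isomorphism_def)
  have "pre_digraph.digraph_isomorphism (pre_digraph.del_vert G x) h"
    using inj ends wf_digraph_del_vert unfolding pre_digraph.digraph_isomorphism_def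
    by (auto simp: del_vert_def intro: inj_on_subset)
  moreover have "pre_digraph.del_vert (app_iso h G) (iso_verts h x) = app_iso h (pre_digraph.del_vert G x)"
    using inj_on_eq_iff[OF inj(1)] ends assms(2)
    by (auto simp: pre_digraph.del_vert_def app_iso_def)
  ultimately show ?thesis
    unfolding digraph_iso_def by blast
qed

lemma deck_eqI:
  assumes "graph G" and "digraph_iso G G'"
  shows "deck G = deck G'"
proof -
  interpret graph G by fact
  from assms(2) obtain h where h: "digraph_isomorphism h" and G': "G' = app_iso h G"
    unfolding digraph_iso_def by blast
  have inj: "inj_on (iso_verts h) (verts G)"
    by (rule digraph_isomorphism_inj_on_verts[OF h])
  have "iso_class (del_vert x) = iso_class (pre_digraph.del_vert G' (iso_verts h x))"
    if "x \<in> verts G" for x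
    unfolding G' by (rule iso_class_eqI[OF wf_digraph_del_vert del_vert_iso[OF h that]])
  then have "deck G = image_mset (\<lambda>x. iso_class (pre_digraph.del_vert G' (iso_verts h x))) (mset_set (verts G))"
    unfolding deck_def by (intro image_mset_cong) simp
  also have "\<dots> = deck G'"
    by (simp add: deck_def G' image_mset_mset_set[OF inj, symmetric] multiset.map_comp comp_def)
  finally show ?thesis .
qed

lemma graph_app_iso:
  assumes "graph G" and h: "pre_digraph.digraph_isomorphism G h"
  shows "graph (app_iso h G)"
proof -
  interpret graph G by fact
  interpret I: fin_digraph "app_iso h G"
    by (rule fin_digraphI_app_iso[OF h])
  note ends = iso_verts_tail[OF h] iso_verts_head[OF h]
  show ?thesis
  proof unfold_locales
    fix e assume "e \<in> arcs (app_iso h G)"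
    then show "tail (app_iso h G) e \<noteq> head (app_iso h G) e"
      using no_loops by (auto simp: ends iso_verts_eq_iff[OF h])
  next
    fix e1 e2
    assume "e1 \<in> arcs (app_iso h G)" "e2 \<in> arcs (app_iso h G)"
      "arc_to_ends (app_iso h G) e1 = arc_to_ends (app_iso h G) e2"
    then show "e1 = e2"
      by (auto simp: arc_to_ends_def ends iso_verts_eq_iff[OF h] intro!: arg_cong[of _ _ "iso_arcs h"] no_multi_arcs)
  next
    have "arcs_ends (app_iso h G) = (\<lambda>(a, b). (iso_verts h a, iso_verts h b)) ` arcs_ends G"
      by (force simp: arcs_ends_def arc_to_ends_def ends)
    then show "symmetric (app_iso h G)"
      using sym_arcs by (force simp: symmetric_def sym_def)
  qed
qed

lemma reconstructibleD:
  assumes G: "graph G" "reconstructible G" and G': "graph G'" and deck: "deck G' = deck G"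
  shows "digraph_iso G' G"
proof -
  interpret G': graph G' by fact
  obtain K :: "nat pair_pre_digraph" where iso: "digraph_iso G' (with_proj K)"
    using iso_class_nonempty[OF G'] unfolding iso_class_def by blast
  then obtain h where h: "G'.digraph_isomorphism h" and K: "with_proj K = app_iso h G'"
    unfolding digraph_iso_def by blast
  have "graph (with_proj K)"
    unfolding K by (rule graph_app_iso[OF G' h])
  moreover have "deck (with_proj K) = deck G"
    using deck_eqI[OF G' iso] deck by simp
  ultimately have "digraph_iso (with_proj K) G"
    using G(2) unfolding reconstructible_def by blast
  with iso show ?thesis by (rule digraph_iso_trans)
qed

section \<open>Anchors\<close>

definition anchor :: "('a, 'b) pre_digraph \<Rightarrow> ('a, 'b) pre_digraph \<Rightarrow> bool" where
  "anchor G H \<longleftrightarrow>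
     induced_subgraph H G \<and> verts H \<noteq> {} \<and> verts H \<noteq> verts G \<and>
     (\<forall>W. W \<subseteq> verts G \<and> W \<noteq> verts H \<longrightarrow> \<not> digraph_iso (G \<restriction> W) H)"

section \<open>Placing two neighborhoods in a graph\<close>

definition neighborhood :: "('a, 'b) pre_digraph \<Rightarrow> 'a \<Rightarrow> 'a set" where
  "neighborhood G v = {u. v \<rightarrow>\<^bsub>G\<^esub> u}"

text \<open>
  The vertex maps of the automorphisms; their values outside \<open>verts H\<close> are unconstrained.
\<close>

definition Aut :: "('a, 'b) pre_digraph \<Rightarrow> ('a \<Rightarrow> 'a) set" where
  "Aut H = {iso_verts h | h. pre_digraph.digraph_isomorphism H h \<and> app_iso h H = H}"

datatype 'a extended = Old 'a | New_x | New_y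

definition extend :: "('a, 'b) pre_digraph \<Rightarrow> 'a set \<Rightarrow> 'a set \<Rightarrow> 'a extended pair_pre_digraph" where
  "extend H S T =
     \<lparr>pverts = Old ` verts H \<union> {New_x, New_y},
      parcs = {(Old a, Old b) | a b. a \<rightarrow>\<^bsub>H\<^esub> b} \<union>
        symcl ({(New_x, Old a) | a. a \<in> S} \<union> {(New_y, Old a) | a. a \<in> T})\<rparr>"

text \<open>Every arc has cost 1; the value is \<open>\<infinity>\<close> if \<open>New_y\<close> cannot be reached from \<open>New_x\<close>.\<close>

definition dist_within :: "('a, 'b) pre_digraph \<Rightarrow> 'a set \<Rightarrow> 'a set \<Rightarrow> ereal" where
  "dist_within H S T = wf_digraph.\<mu> (with_proj (extend H S T)) (\<lambda>_. 1) New_x New_y"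

definition distance_specifies_placement ::
    "('a, 'b) pre_digraph \<Rightarrow> 'a set \<Rightarrow> 'a set \<Rightarrow> bool" where
  "distance_specifies_placement H S T \<longleftrightarrow>
     (\<forall>\<alpha> \<in> Aut H. \<forall>\<beta> \<in> Aut H. dist_within H (\<alpha> ` S) (\<beta> ` T) = dist_within H S T \<longrightarrow>
        (\<exists>\<gamma> \<in> Aut H. {#\<gamma> ` S, \<gamma> ` T#} = {#\<alpha> ` S, \<beta> ` T#}))"

end

theory Submission
  imports Defs
begin

text \<open>
  Let \<open>K\<close> have the same deck as \<open>G\<close>, so that some bijection \<open>\<pi>\<close> of the vertices satisfies
  \<open>G - x \<cong> K - \<pi> x\<close> for every \<open>x\<close>. By Kelly's counting argument, \<open>G\<close> and \<open>K\<close> have equally many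
  vertex sets of any given size below \<open>|G|\<close> whose induced subgraphs have a given isomorphism-invariant
  property. Counting copies of \<open>H\<close> shows that \<open>K\<close> contains a single copy of \<open>H\<close>; as \<open>K - \<pi> v\<close> and
  \<open>K - \<pi> w\<close> both contain it, it is \<open>K - {\<pi> v, \<pi> w}\<close> (\<open>anchor_transfer\<close>). An isomorphism
  \<open>k\<close> from \<open>G - w\<close> to \<open>K - \<pi> w\<close> and an isomorphism \<open>g\<close> from \<open>G - v\<close> to \<open>K - \<pi> v\<close> therefore both
  restrict to isomorphisms between the two copies of \<open>H\<close>, and \<open>k\<close> sends \<open>v\<close> to \<open>\<pi> v\<close> while \<open>g\<close> sends
  \<open>w\<close> to \<open>\<pi> w\<close>. So \<open>g\<close> identifies the anchor of \<open>K\<close> with \<open>H\<close> in such a way that the neighborhoods of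
  \<open>\<pi> v\<close> and \<open>\<pi> w\<close> become \<open>\<alpha> s\<^sub>v\<close> and \<open>s\<^sub>w\<close>, with the automorphism \<open>\<alpha> = g\<^sup>-\<^sup>1 k\<close> of \<open>H\<close>.

  To apply the hypothesis on distances one has to see that the distance within \<open>H\<close> is the same
  for \<open>v, w\<close> as for \<open>\<pi> v, \<pi> w\<close>. Inclusion and exclusion turns Kelly's argument into one that counts
  vertex sets containing \<open>v\<close> and \<open>w\<close> (\<open>subset_through_transfer\<close>); for two-element sets this shows that
  \<open>v\<close> and \<open>w\<close> are adjacent in \<open>G\<close> iff \<open>\<pi> v\<close> and \<open>\<pi> w\<close> are adjacent in \<open>K\<close>. The distance is one less
  than the least size of a set \<open>U\<close> such that \<open>v\<close> and \<open>w\<close> are connected in \<open>G[U]\<close> without using the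
  edge \<open>vw\<close>. This description singles out a pair of vertices, which an isomorphism-invariant property
  cannot do. But in a minimal such \<open>U\<close>, which induces a path or a cycle, \<^emph>\<open>every\<close> pair that agrees with
  \<open>v, w\<close> in being adjacent or not is connected without its own edge (\<open>irreducible_pairs_joined\<close>),
  and this is an invariant property of \<open>G[U]\<close>. It transfers \<open>U\<close> to \<open>K\<close> when \<open>U\<close> is not the whole
  vertex set. If it is, then \<open>G - v\<close> and \<open>G - w\<close> are connected, hence so are \<open>K - \<pi> v\<close> and
  \<open>K - \<pi> w\<close>, and a path through any third vertex joins \<open>\<pi> v\<close> to \<open>\<pi> w\<close> avoiding their edge
  (\<open>joined_transfer\<close>).

  The hypothesis now yields \<open>\<gamma>\<close>, and \<open>g \<gamma>\<close> extends to an isomorphism of \<open>G\<close> onto \<open>K\<close> that sends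
  \<open>v, w\<close> to \<open>\<pi> v, \<pi> w\<close> in one of the two orders.
\<close>

section \<open>Isomorphisms between induced subgraphs\<close>

text \<open>
  Only the pairs of \<open>E\<close> inside \<open>X\<close> matter, so the edge relation of a graph serves for all its induced
  subgraphs: the subgraph induced by \<open>X\<close> is represented by \<open>X\<close> and the unrestricted relation.
\<close>

definition iso_on :: "('a \<Rightarrow> 'b) \<Rightarrow> 'a set \<Rightarrow> 'a rel \<Rightarrow> 'b set \<Rightarrow> 'b rel \<Rightarrow> bool" where
  "iso_on f X E Y F \<longleftrightarrow> bij_betw f X Y \<and> (\<forall>a\<in>X. \<forall>b\<in>X. (f a, f b) \<in> F \<longleftrightarrow> (a, b) \<in> E)"

definition isomorphic :: "'a set \<Rightarrow> 'a rel \<Rightarrow> 'b set \<Rightarrow> 'b rel \<Rightarrow> bool" where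
  "isomorphic X E Y F \<longleftrightarrow> (\<exists>f. iso_on f X E Y F)"

lemma iso_on_id: "iso_on id X E X E"
  by (simp add: iso_on_def)

lemma iso_on_comp: "iso_on f X E Y F \<Longrightarrow> iso_on g Y F Z D \<Longrightarrow> iso_on (g \<circ> f) X E Z D"
  unfolding iso_on_def by (auto intro: bij_betw_trans dest: bij_betwE)

lemma iso_on_inv: "iso_on f X E Y F \<Longrightarrow> iso_on (inv_into X f) Y F X E"
  unfolding iso_on_def
  by (metis bij_betw_imp_surj_on bij_betw_inv_into f_inv_into_f inv_into_into)

lemma iso_on_subset: "iso_on f X E Y F \<Longrightarrow> W \<subseteq> X \<Longrightarrow> iso_on f W E (f ` W) F"
  unfolding iso_on_def by (auto intro: bij_betw_subset)

lemma iso_on_image: "iso_on f X E Y F \<Longrightarrow> f ` X = Y"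
  by (simp add: iso_on_def bij_betw_def)

lemma iso_on_subset_to:
  "iso_on f X E Y F \<Longrightarrow> W \<subseteq> X \<Longrightarrow> f ` W = Z \<Longrightarrow> iso_on f W E Z F"
  using iso_on_subset by blast

lemma iso_on_image_nbrs:
  assumes "iso_on g X E Y F" "Z \<subseteq> X" "u \<in> X"
  shows "g ` {x \<in> Z. (u, x) \<in> E} = {y \<in> g ` Z. (g u, y) \<in> F}"
  using assms unfolding iso_on_def by blast

lemma isomorphic_sym: "isomorphic X E Y F \<Longrightarrow> isomorphic Y F X E"
  unfolding isomorphic_def using iso_on_inv by blast

lemma isomorphic_trans: "isomorphic X E Y F \<Longrightarrow> isomorphic Y F Z D \<Longrightarrow> isomorphic X E Z D"
  unfolding isomorphic_def using iso_on_comp by blast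

lemma isomorphic_card: "isomorphic X E Y F \<Longrightarrow> card X = card Y"
  unfolding isomorphic_def iso_on_def using bij_betw_same_card by blast

text \<open>
  As \<open>\<phi>\<close> is injective, mapping the neighborhoods of \<open>v\<close> and \<open>w\<close> onto those of \<open>v'\<close> and \<open>w'\<close> as sets
  settles all edges between the two new vertices and the rest. The lemma serves to glue the final
  isomorphism together, and to recognize \<open>extend\<close> as a graph without the edge between two vertices.
\<close>

lemma iso_on_add_two:
  assumes \<phi>: "iso_on \<phi> (V - {v, w}) E (V' - {v', w'}) E'"
    and "v \<in> V" "w \<in> V" "v \<noteq> w" "v' \<in> V'" "w' \<in> V'" "v' \<noteq> w'"
    and "sym E" "irrefl E" "sym E'" "irrefl E'"
    and adj: "(v, w) \<in> E \<longleftrightarrow> (v', w') \<in> E'"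
    and nv: "\<phi> ` {x \<in> V - {v, w}. (v, x) \<in> E} = {y \<in> V' - {v', w'}. (v', y) \<in> E'}"
    and nw: "\<phi> ` {x \<in> V - {v, w}. (w, x) \<in> E} = {y \<in> V' - {v', w'}. (w', y) \<in> E'}"
  shows "iso_on (\<phi>(v := v', w := w')) V E V' E'"
proof -
  let ?H = "V - {v, w}" and ?H' = "V' - {v', w'}"
  define f where "f = \<phi>(v := v', w := w')"
  have bij: "bij_betw \<phi> ?H ?H'" and edge: "\<And>a b. a \<in> ?H \<Longrightarrow> b \<in> ?H \<Longrightarrow> (\<phi> a, \<phi> b) \<in> E' \<longleftrightarrow> (a, b) \<in> E"
    using \<phi> by (auto simp: iso_on_def)
  have f: "f v = v'" "f w = w'" "\<And>x. x \<in> ?H \<Longrightarrow> f x = \<phi> x"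
    using assms(4) by (auto simp: f_def)
  have pull: "(v', \<phi> x) \<in> E' \<longleftrightarrow> (v, x) \<in> E" "(w', \<phi> x) \<in> E' \<longleftrightarrow> (w, x) \<in> E" if "x \<in> ?H" for x
  proof -
    have inj: "\<phi> x \<in> \<phi> ` S \<longleftrightarrow> x \<in> S" if "S \<subseteq> ?H" for S
      using inj_on_image_mem_iff[OF bij_betw_imp_inj_on[OF bij] \<open>x \<in> ?H\<close> that] .
    have "\<phi> x \<in> ?H'"
      using bij that bij_betwE by blast
    then show "(v', \<phi> x) \<in> E' \<longleftrightarrow> (v, x) \<in> E" "(w', \<phi> x) \<in> E' \<longleftrightarrow> (w, x) \<in> E"
      using that inj[of "{x \<in> ?H. (v, x) \<in> E}"] inj[of "{x \<in> ?H. (w, x) \<in> E}"]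
      unfolding nv nw by auto
  qed
  have flip: "(a, b) \<in> E \<longleftrightarrow> (b, a) \<in> E" "(c, d) \<in> E' \<longleftrightarrow> (d, c) \<in> E'" for a b c d
    using assms(8,10) by (meson symE)+
  have pull': "(\<phi> x, v') \<in> E' \<longleftrightarrow> (x, v) \<in> E" "(\<phi> x, w') \<in> E' \<longleftrightarrow> (x, w) \<in> E" if "x \<in> ?H" for x
    using pull[OF that] flip by metis+
  have adj': "(w, v) \<in> E \<longleftrightarrow> (w', v') \<in> E'"
    using adj flip by metis
  have loops: "(x, x) \<notin> E" "(y, y) \<notin> E'" for x y
    using assms(9,11) by (auto simp: irrefl_def)
  have edges: "(f a, f b) \<in> E' \<longleftrightarrow> (a, b) \<in> E" if ab: "a \<in> V" "b \<in> V" for a b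
  proof -
    have "a \<in> ?H \<or> a = v \<or> a = w" "b \<in> ?H \<or> b = v \<or> b = w"
      using ab by auto
    then show ?thesis
      by (elim disjE) (simp_all only: f edge pull pull' adj adj' loops)
  qed
  have "bij_betw f ?H ?H'"
    using bij by (simp only: bij_betw_cong[OF f(3)])
  moreover have "bij_betw f {v, w} {v', w'}"
    using assms(4,7) f by (auto simp: bij_betw_def)
  ultimately have "bij_betw f (?H \<union> {v, w}) (?H' \<union> {v', w'})"
    by (rule bij_betw_combine) auto
  moreover have "?H \<union> {v, w} = V" "?H' \<union> {v', w'} = V'"
    using assms(2,3,5,6) by auto
  ultimately show ?thesis
    using edges unfolding iso_on_def f_def by simp
qed

text \<open>
  The classical name for two graphs with the same deck, with the matching of the cards made explicit.
\<close>

definition hypomorphic :: "('a \<Rightarrow> 'b) \<Rightarrow> 'a set \<Rightarrow> 'a rel \<Rightarrow> 'b set \<Rightarrow> 'b rel \<Rightarrow> bool" where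
  "hypomorphic \<pi> V E V' E' \<longleftrightarrow>
     bij_betw \<pi> V V' \<and> (\<forall>x\<in>V. isomorphic (V - {x}) E (V' - {\<pi> x}) E')"

lemma hypomorphic_sym:
  assumes "hypomorphic \<pi> V E V' E'"
  shows "hypomorphic (inv_into V \<pi>) V' E' V E"
proof -
  have bij: "bij_betw \<pi> V V'"
    and iso: "\<And>x. x \<in> V \<Longrightarrow> isomorphic (V - {x}) E (V' - {\<pi> x}) E'"
    using assms by (auto simp: hypomorphic_def)
  have "isomorphic (V' - {y}) E' (V - {inv_into V \<pi> y}) E" if "y \<in> V'" for y
  proof (rule isomorphic_sym)
    have "inv_into V \<pi> y \<in> V"
      using bij_betw_apply[OF bij_betw_inv_into[OF bij] that] .
    from iso[OF this] show "isomorphic (V - {inv_into V \<pi> y}) E (V' - {y}) E'"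
      by (simp only: bij_betw_inv_into_right[OF bij that])
  qed
  then show ?thesis
    using bij_betw_inv_into[OF bij] by (simp add: hypomorphic_def)
qed

section \<open>Kelly's counting argument\<close>

definition subset_count :: "'a set \<Rightarrow> nat \<Rightarrow> ('a set \<Rightarrow> bool) \<Rightarrow> nat" where
  "subset_count V k P = card {W. W \<subseteq> V \<and> card W = k \<and> P W}"

text \<open>
  Isomorphism-invariance of a property of induced subgraphs. The property appears once for each of the
  two graphs because their vertices may have different types.
\<close>

definition same_property ::
    "('a set \<Rightarrow> bool) \<Rightarrow> 'a set \<Rightarrow> 'a rel \<Rightarrow> ('b set \<Rightarrow> bool) \<Rightarrow> 'b set \<Rightarrow> 'b rel \<Rightarrow> bool" where
  "same_property P V E P' V' E' \<longleftrightarrow>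
     (\<forall>W\<subseteq>V. \<forall>W'\<subseteq>V'. isomorphic W E W' E' \<longrightarrow> (P W \<longleftrightarrow> P' W'))"

lemma subset_count_iso:
  assumes "same_property P V E P' V' E'" "X \<subseteq> V" "X' \<subseteq> V'" "isomorphic X E X' E'"
  shows "subset_count X k P = subset_count X' k P'"
proof -
  obtain f where f: "iso_on f X E X' E'"
    using assms(4) unfolding isomorphic_def by blast
  then have bij: "bij_betw f X X'"
    by (simp add: iso_on_def)
  have P: "P W \<longleftrightarrow> P' (f ` W)" and c: "card (f ` W) = card W" if "W \<subseteq> X" for W
  proof -
    have "isomorphic W E (f ` W) E'"
      using iso_on_subset[OF f that] unfolding isomorphic_def by blast
    moreover have "f ` W \<subseteq> X'"
      using iso_on_image[OF f] that by blast
    ultimately show "P W \<longleftrightarrow> P' (f ` W)" "card (f ` W) = card W"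
      using assms(1-3) that isomorphic_card[of W E "f ` W" E'] unfolding same_property_def
      by (meson order_trans, simp)
  qed
  have "bij_betw (image f) {W. W \<subseteq> X \<and> card W = k \<and> P W} {W. W \<subseteq> X' \<and> card W = k \<and> P' W}"
  proof (rule bij_betw_subset[OF bij_betw_Pow[OF bij]])
    show "(`) f ` {W. W \<subseteq> X \<and> card W = k \<and> P W} = {W. W \<subseteq> X' \<and> card W = k \<and> P' W}"
    proof (intro equalityI subsetI)
      fix W' assume W': "W' \<in> {W. W \<subseteq> X' \<and> card W = k \<and> P' W}"
      then obtain W where "W \<subseteq> X" "W' = f ` W"
        using iso_on_image[OF f] by (metis (no_types, lifting) mem_Collect_eq subset_imageE)
      then show "W' \<in> (`) f ` {W. W \<subseteq> X \<and> card W = k \<and> P W}"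
        using W' P c by auto
    qed (use P c iso_on_image[OF f] in auto)
  qed auto
  then show ?thesis
    unfolding subset_count_def by (rule bij_betw_same_card)
qed

text \<open>
  A set of size \<open>k\<close> is contained in \<open>V - {x}\<close> for exactly \<open>card V - k\<close> of the vertices \<open>x\<close> of \<open>V\<close>.
\<close>

lemma sum_subset_count_cards:
  assumes "finite V"
  shows "(\<Sum>x\<in>V. subset_count (V - {x}) k P) = (card V - k) * subset_count V k P"
proof -
  let ?F = "{W. W \<subseteq> V \<and> card W = k \<and> P W}"
  have fin: "finite ?F"
    using assms by simp
  have "subset_count (V - {x}) k P = (\<Sum>W\<in>?F. if x \<in> W then 0 else 1)" for x
  proof -
    have "{W. W \<subseteq> V - {x} \<and> card W = k \<and> P W} = {W \<in> ?F. x \<notin> W}"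
      by auto
    then show ?thesis
      unfolding subset_count_def using fin by (simp add: sum.If_cases Int_def conj_commute)
  qed
  then have "(\<Sum>x\<in>V. subset_count (V - {x}) k P) = (\<Sum>W\<in>?F. \<Sum>x\<in>V. if x \<in> W then 0 else 1)"
    by (simp add: sum.swap[of _ _ V])
  also have "\<dots> = (\<Sum>W\<in>?F. card V - k)"
  proof (rule sum.cong)
    fix W assume "W \<in> ?F"
    then have "W \<subseteq> V" "card W = k" by auto
    moreover have "(\<Sum>x\<in>V. if x \<in> W then 0 else 1::nat) = card (V - W)"
      using assms by (simp add: sum.If_cases Diff_eq)
    ultimately show "(\<Sum>x\<in>V. if x \<in> W then 0 else 1::nat) = card V - k"
      using assms by (simp add: card_Diff_subset finite_subset)
  qed simp
  finally show ?thesis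
    by (simp add: subset_count_def)
qed

text \<open>
  Kelly's lemma. The cards determine the left-hand side of the double count
  \<open>sum_subset_count_cards\<close>, and the factor there is positive because \<open>k < card V\<close>.
\<close>

lemma kelly:
  assumes "finite V" "hypomorphic \<pi> V E V' E'" "same_property P V E P' V' E'" "k < card V"
  shows "subset_count V k P = subset_count V' k P'"
proof -
  have bij: "bij_betw \<pi> V V'"
    and iso: "\<And>x. x \<in> V \<Longrightarrow> isomorphic (V - {x}) E (V' - {\<pi> x}) E'"
    using assms(2) by (auto simp: hypomorphic_def)
  have fin': "finite V'" and card': "card V' = card V"
    using bij assms(1) bij_betw_finite bij_betw_same_card by fastforce+
  have "(card V - k) * subset_count V k P = (\<Sum>x\<in>V. subset_count (V - {x}) k P)"
    by (rule sum_subset_count_cards[OF assms(1), symmetric])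
  also have "\<dots> = (\<Sum>x\<in>V. subset_count (V' - {\<pi> x}) k P')"
    by (rule sum.cong) (auto intro!: subset_count_iso[OF assms(3)] iso)
  also have "\<dots> = (\<Sum>y\<in>V'. subset_count (V' - {y}) k P')"
    by (rule sum.reindex_bij_betw[OF bij])
  also have "\<dots> = (card V - k) * subset_count V' k P'"
    by (simp add: sum_subset_count_cards[OF fin'] card')
  finally show ?thesis
    using assms(4) by simp
qed

text \<open>
  Inclusion and exclusion over the sets that miss \<open>v\<close> and those that miss \<open>w\<close>. All terms except the
  first one count sets in the graph or in the subgraphs obtained by deleting \<open>v\<close>, \<open>w\<close> or both.
\<close>

lemma subset_count_through:
  assumes "finite V" "v \<in> V" "w \<in> V"
  shows "subset_count V k (\<lambda>W. v \<in> W \<and> w \<in> W \<and> P W)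
      + (subset_count (V - {v}) k P + subset_count (V - {w}) k P)
    = subset_count V k P + subset_count (V - {v, w}) k P"
proof -
  let ?F = "\<lambda>X. {W. W \<subseteq> X \<and> card W = k \<and> P W}"
  have fin: "finite (?F X)" if "X \<subseteq> V" for X
    using finite_subset[OF that assms(1)] by simp
  have "?F (V - {v}) \<inter> ?F (V - {w}) = ?F (V - {v, w})"
    by blast
  then have 1: "subset_count (V - {v}) k P + subset_count (V - {w}) k P
      = card (?F (V - {v}) \<union> ?F (V - {w})) + subset_count (V - {v, w}) k P"
    unfolding subset_count_def
    using card_Un_Int[OF fin[of "V - {v}"] fin[of "V - {w}"]] by auto
  have "?F V = {W. W \<subseteq> V \<and> card W = k \<and> v \<in> W \<and> w \<in> W \<and> P W} \<union> (?F (V - {v}) \<union> ?F (V - {w}))"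
    by blast
  moreover have "{W. W \<subseteq> V \<and> card W = k \<and> v \<in> W \<and> w \<in> W \<and> P W} \<inter> (?F (V - {v}) \<union> ?F (V - {w})) = {}"
    by blast
  ultimately have "card (?F V) = card {W. W \<subseteq> V \<and> card W = k \<and> v \<in> W \<and> w \<in> W \<and> P W}
      + card (?F (V - {v}) \<union> ?F (V - {w}))"
    using assms(1) fin by (metis (no_types, lifting) card_Un_disjoint finite_Un order_refl)
  with 1 show ?thesis
    unfolding subset_count_def by simp
qed

text \<open>
  All other terms of \<open>subset_count_through\<close> agree for the two graphs: by Kelly's lemma, by the cards at
  \<open>v\<close> and \<open>w\<close>, and by the assumption on the graphs without both vertices. So properties of induced
  subgraphs can be traced around a specific pair of vertices.
\<close>

lemma subset_through_transfer:
  assumes "finite V" "hypomorphic \<pi> V E V' E'" "same_property P V E P' V' E'"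
    and "v \<in> V" "w \<in> V" "v \<noteq> w" "isomorphic (V - {v, w}) E (V' - {\<pi> v, \<pi> w}) E'"
    and W: "W \<subseteq> V" "card W < card V" "v \<in> W" "w \<in> W" "P W"
  shows "\<exists>W'\<subseteq>V'. card W' = card W \<and> \<pi> v \<in> W' \<and> \<pi> w \<in> W' \<and> P' W'"
proof -
  let ?k = "card W"
  have bij: "bij_betw \<pi> V V'"
    and iso: "\<And>x. x \<in> V \<Longrightarrow> isomorphic (V - {x}) E (V' - {\<pi> x}) E'"
    using assms(2) by (auto simp: hypomorphic_def)
  have fin': "finite V'"
    using bij assms(1) bij_betw_finite by blast
  have mem': "\<pi> v \<in> V'" "\<pi> w \<in> V'"
    using bij assms(4,5) bij_betwE by blast+
  have "subset_count V ?k (\<lambda>W. v \<in> W \<and> w \<in> W \<and> P W)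
      = subset_count V' ?k (\<lambda>W. \<pi> v \<in> W \<and> \<pi> w \<in> W \<and> P' W)"
    using subset_count_through[OF assms(1,4,5), of ?k P] subset_count_through[OF fin' mem', of ?k P']
      kelly[OF assms(1-3) W(2)]
      subset_count_iso[OF assms(3) _ _ iso[OF assms(4)], of ?k]
      subset_count_iso[OF assms(3) _ _ iso[OF assms(5)], of ?k]
      subset_count_iso[OF assms(3) _ _ assms(7), of ?k]
    by (simp add: subset_iff)
  moreover have "subset_count V ?k (\<lambda>W. v \<in> W \<and> w \<in> W \<and> P W) \<noteq> 0"
    unfolding subset_count_def using assms(1) W by auto
  ultimately show ?thesis
    unfolding subset_count_def
    by (smt (verit, del_insts) Collect_empty_eq card.empty)
qed

text \<open>
  The instance for sets of size two: \<open>{v, w}\<close> is the only one containing \<open>v\<close> and \<open>w\<close>. The third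
  vertex makes the size smaller than that of the graph.
\<close>

lemma adjacent_transfer:
  assumes "finite V" "hypomorphic \<pi> V E V' E'" "sym E'" "irrefl E'"
    and vw: "v \<in> V" "w \<in> V" "v \<noteq> w" "isomorphic (V - {v, w}) E (V' - {\<pi> v, \<pi> w}) E'"
    and "V - {v, w} \<noteq> {}" and adj: "(v, w) \<in> E"
  shows "(\<pi> v, \<pi> w) \<in> E'"
proof -
  have "\<pi> v \<noteq> \<pi> w"
    using assms(2) vw by (auto simp: hypomorphic_def bij_betw_def inj_on_eq_iff)
  have same: "same_property (\<lambda>W. \<exists>a\<in>W. \<exists>b\<in>W. (a, b) \<in> E) V E (\<lambda>W. \<exists>a\<in>W. \<exists>b\<in>W. (a, b) \<in> E') V' E'"
    unfolding same_property_def isomorphic_def iso_on_def bij_betw_def by blast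
  have "card {v, w} < card V"
    using assms(1,9) vw by (intro psubset_card_mono) auto
  from subset_through_transfer[OF assms(1,2) same vw _ this] vw(1,2) adj
  obtain W' where W': "card W' = card {v, w}" "\<pi> v \<in> W'" "\<pi> w \<in> W'" "\<exists>a\<in>W'. \<exists>b\<in>W'. (a, b) \<in> E'"
    by auto
  have "{\<pi> v, \<pi> w} = W'"
    using W'(1-3) vw(3) \<open>\<pi> v \<noteq> \<pi> w\<close> by (intro card_seteq) (auto intro: card_ge_0_finite)
  with W'(4) assms(3,4) show ?thesis
    by (auto simp: irrefl_def sym_def)
qed

text \<open>
  By Kelly's lemma, the second graph contains exactly one copy \<open>H'\<close> of the anchor. An isomorphism
  between the cards at \<open>v\<close>, or at \<open>w\<close>, maps the anchor to a copy of it, hence onto \<open>H'\<close>; so \<open>H'\<close>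
  avoids both \<open>\<pi> v\<close> and \<open>\<pi> w\<close>, and for reasons of size contains everything else.
\<close>

lemma anchor_transfer:
  assumes "finite V" "hypomorphic \<pi> V E V' E'" "v \<in> V" "w \<in> V" "v \<noteq> w"
    and once: "\<And>W. W \<subseteq> V \<Longrightarrow> isomorphic W E (V - {v, w}) E \<Longrightarrow> W = V - {v, w}"
  shows "iso_on g (V - {v}) E (V' - {\<pi> v}) E' \<Longrightarrow> g ` (V - {v, w}) = V' - {\<pi> v, \<pi> w}"
    and "iso_on g (V - {w}) E (V' - {\<pi> w}) E' \<Longrightarrow> g ` (V - {v, w}) = V' - {\<pi> v, \<pi> w}"
proof -
  let ?H = "V - {v, w}" and ?k = "card V - 2"
  have bij: "bij_betw \<pi> V V'"
    and iso: "\<And>x. x \<in> V \<Longrightarrow> isomorphic (V - {x}) E (V' - {\<pi> x}) E'"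
    using assms(2) by (auto simp: hypomorphic_def)
  have fin': "finite V'" and card': "card V' = card V"
    using bij assms(1) bij_betw_finite bij_betw_same_card by fastforce+
  have mem': "\<pi> v \<in> V'" "\<pi> w \<in> V'" "\<pi> v \<noteq> \<pi> w"
    using bij assms(3-5) by (auto simp: bij_betw_def inj_on_eq_iff)
  have "{v, w} \<subseteq> V" "{\<pi> v, \<pi> w} \<subseteq> V'"
    using assms(3,4) mem' by auto
  then have cardH: "card ?H = ?k" "card (V' - {\<pi> v, \<pi> w}) = ?k"
    using assms(1,5) fin' card' mem'(3) by (simp_all add: card_Diff_subset)
  have k: "?k < card V"
    using assms(1,3) by (intro diff_less) (auto simp: card_gt_0_iff)
  have "same_property (\<lambda>W. isomorphic W E ?H E) V E (\<lambda>W. isomorphic W E' ?H E) V' E'"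
    unfolding same_property_def
    using isomorphic_trans[OF isomorphic_sym] isomorphic_trans by (intro allI impI iffI)
  from kelly[OF assms(1,2) this k]
  have "card {W. W \<subseteq> V' \<and> card W = ?k \<and> isomorphic W E' ?H E}
      = card {W. W \<subseteq> V \<and> card W = ?k \<and> isomorphic W E ?H E}"
    by (simp add: subset_count_def)
  also have "{W. W \<subseteq> V \<and> card W = ?k \<and> isomorphic W E ?H E} = {?H}"
  proof -
    have "isomorphic ?H E ?H E"
      unfolding isomorphic_def using iso_on_id by blast
    then show ?thesis
      using once cardH(1) by auto
  qed
  finally have "card {W. W \<subseteq> V' \<and> card W = ?k \<and> isomorphic W E' ?H E} = 1"
    by simp
  then obtain H' where H': "{W. W \<subseteq> V' \<and> card W = ?k \<and> isomorphic W E' ?H E} = {H'}"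
    by (auto simp: card_1_singleton_iff)
  have copy: "g ` ?H = H' \<and> H' \<subseteq> V' - {\<pi> x}"
    if g: "iso_on g (V - {x}) E (V' - {\<pi> x}) E'" and x: "x \<in> {v, w}" for g x
  proof -
    have sub: "?H \<subseteq> V - {x}"
      using x by auto
    have img: "g ` ?H \<subseteq> V' - {\<pi> x}"
      using sub iso_on_image[OF g] by blast
    have "isomorphic ?H E (g ` ?H) E'"
      using iso_on_subset[OF g sub] unfolding isomorphic_def by blast
    then have "g ` ?H \<in> {W. W \<subseteq> V' \<and> card W = ?k \<and> isomorphic W E' ?H E}"
      using img cardH(1) isomorphic_card isomorphic_sym by fastforce
    with H' img show ?thesis
      by simp
  qed
  have "H' = V' - {\<pi> v, \<pi> w}"
  proof (rule card_seteq)
    obtain g1 where "iso_on g1 (V - {v}) E (V' - {\<pi> v}) E'"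
      using iso[OF assms(3)] by (auto simp: isomorphic_def)
    moreover obtain g2 where "iso_on g2 (V - {w}) E (V' - {\<pi> w}) E'"
      using iso[OF assms(4)] by (auto simp: isomorphic_def)
    ultimately show "H' \<subseteq> V' - {\<pi> v, \<pi> w}"
      using copy by blast
    have "H' \<in> {W. W \<subseteq> V' \<and> card W = ?k \<and> isomorphic W E' ?H E}"
      by (simp only: H' singletonI)
    then show "card (V' - {\<pi> v, \<pi> w}) \<le> card H'"
      using cardH(2) by simp
  qed (use fin' in simp)
  then show "iso_on g (V - {v}) E (V' - {\<pi> v}) E' \<Longrightarrow> g ` ?H = V' - {\<pi> v, \<pi> w}"
    and "iso_on g (V - {w}) E (V' - {\<pi> w}) E' \<Longrightarrow> g ` ?H = V' - {\<pi> v, \<pi> w}"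
    using copy by blast+
qed

section \<open>Connections that avoid a given edge\<close>

text \<open>
  The vertices \<open>a\<close> and \<open>b\<close> are connected inside \<open>U\<close> without their own edge. Ignoring this edge is what
  makes the distance within \<open>H\<close> independent of whether \<open>v\<close> and \<open>w\<close> are adjacent.
\<close>

definition joined :: "'a rel \<Rightarrow> 'a set \<Rightarrow> 'a \<Rightarrow> 'a \<Rightarrow> bool" where
  "joined E U a b \<longleftrightarrow> (a, b) \<in> (Restr E U - {(a, b), (b, a)})\<^sup>*"

lemma rtrancl_image:
  assumes "(a, b) \<in> R\<^sup>*" and "\<And>x y. (x, y) \<in> R \<Longrightarrow> (f x, f y) \<in> S\<^sup>*"
  shows "(f a, f b) \<in> S\<^sup>*"
  using assms(1) by induction (auto intro: rtrancl_trans assms(2))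

lemma iso_on_rtrancl:
  assumes "iso_on f X E Y F" "(a, b) \<in> (Restr E X)\<^sup>*"
  shows "(f a, f b) \<in> (Restr F Y)\<^sup>*"
  using assms(2)
  by (rule rtrancl_image) (use assms(1) in \<open>auto simp: iso_on_def dest: bij_betwE\<close>)

lemma iso_on_joined:
  assumes "iso_on f U E Y F" "a \<in> U" "b \<in> U" "joined E U a b"
  shows "joined F Y (f a) (f b)"
proof -
  have "bij_betw f U Y"
    using assms(1) by (simp add: iso_on_def)
  then have "f x = f y \<longleftrightarrow> x = y" if "x \<in> U" "y \<in> U" for x y
    using that by (metis bij_betw_imp_inj_on inj_on_eq_iff)
  then have step: "(x, y) \<in> Restr E U - {(a, b), (b, a)} \<Longrightarrow>
      (f x, f y) \<in> Restr F Y - {(f a, f b), (f b, f a)}" for x y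
    using assms(1-3) by (auto simp: iso_on_def dest: bij_betwE)
  show ?thesis
    using assms(4) unfolding joined_def by (rule rtrancl_image) (rule r_into_rtrancl[OF step])
qed

text \<open>
  The Boolean \<open>e\<close> selects the adjacent or the non-adjacent pairs. Unlike \<open>joined\<close> for a fixed pair,
  the condition on all selected pairs is an invariant of the induced subgraph, so that it can be counted.
\<close>

lemma all_pairs_joined_iso:
  assumes "isomorphic X E Y F"
    and "\<forall>a\<in>X. \<forall>b\<in>X. ((a, b) \<in> E \<longleftrightarrow> e) \<longrightarrow> joined E X a b"
  shows "\<forall>a\<in>Y. \<forall>b\<in>Y. ((a, b) \<in> F \<longleftrightarrow> e) \<longrightarrow> joined F Y a b"
proof -
  obtain f where f: "iso_on f X E Y F"
    using assms(1) by (auto simp: isomorphic_def)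
  have "joined F Y (f a) (f b)" if "a \<in> X" "b \<in> X" "(f a, f b) \<in> F \<longleftrightarrow> e" for a b
    using that assms(2) iso_on_joined[OF f, of a b] f by (auto simp: iso_on_def)
  then show ?thesis
    using iso_on_image[OF f] by blast
qed

lemma joined_sym:
  assumes "sym E" "joined E U a b"
  shows "joined E U b a"
proof -
  have "sym ((Restr E U - {(a, b), (b, a)})\<^sup>*)"
    using assms(1) by (intro sym_rtrancl) (auto simp: sym_def)
  from symD[OF this] assms(2) show ?thesis
    by (simp add: joined_def insert_commute)
qed

lemma joined_remove_edge: "joined (E - {(v, w), (w, v)}) U v w \<longleftrightarrow> joined E U v w"
proof -
  have "Restr (E - {(v, w), (w, v)}) U - {(v, w), (w, v)} = Restr E U - {(v, w), (w, v)}"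
    by blast
  then show ?thesis
    by (simp only: joined_def)
qed

text \<open>
  Suppose that a connection of \<open>v\<close> and \<open>w\<close> inside \<open>U\<close> can leave and enter \<open>A\<close> only at a single vertex
  \<open>c\<close>. Sending all vertices outside \<open>A\<close> to \<open>c\<close> then maps it to a connection inside \<open>A\<close>, some steps
  of which stand still.
\<close>

lemma joined_retract:
  assumes "sym E" "joined E U v w" "v \<in> A" "w \<in> A"
    and exit: "\<And>x y. (x, y) \<in> Restr E U - {(v, w), (w, v)} \<Longrightarrow> x \<in> A \<Longrightarrow> y \<notin> A \<Longrightarrow> x = c"
  shows "joined E A v w"
proof -
  (* The retraction onto A; an edge leaving A starts in c and becomes stationary. *)
  define f where "f x = (if x \<in> A then x else c)" for x
  let ?R = "Restr E U - {(v, w), (w, v)}" and ?S = "Restr E A - {(v, w), (w, v)}"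
  have step: "(f x, f y) \<in> ?S\<^sup>*" if "(x, y) \<in> ?R" for x y
  proof -
    have "(y, x) \<in> ?R"
      using that assms(1) by (auto simp: sym_def)
    then show ?thesis
      using that exit[of x y] exit[of y x] by (auto simp: f_def)
  qed
  have "(f v, f w) \<in> ?S\<^sup>*"
    using assms(2) unfolding joined_def by (rule rtrancl_image) (rule step)
  then show ?thesis
    using assms(3,4) by (simp add: f_def joined_def)
qed

text \<open>
  Such a set induces a path from \<open>v\<close> to \<open>w\<close>, or a cycle if \<open>v\<close> and \<open>w\<close> are adjacent. The two
  consequences below are obtained from minimality through retractions, without ordering the vertices
  along the path.
\<close>

definition irreducibly_joined :: "'a rel \<Rightarrow> 'a set \<Rightarrow> 'a \<Rightarrow> 'a \<Rightarrow> bool" where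
  "irreducibly_joined E U v w \<longleftrightarrow> v \<in> U \<and> w \<in> U \<and> joined E U v w \<and>
     (\<forall>A\<subseteq>U. v \<in> A \<longrightarrow> w \<in> A \<longrightarrow> joined E A v w \<longrightarrow> A = U)"

lemma irreducibly_joined_sym:
  "sym E \<Longrightarrow> irreducibly_joined E U v w \<Longrightarrow> irreducibly_joined E U w v"
  unfolding irreducibly_joined_def by (blast intro: joined_sym)

lemma joined_imp_irreducible:
  assumes "finite U" "v \<in> U" "w \<in> U" "joined E U v w"
  shows "\<exists>A\<subseteq>U. irreducibly_joined E A v w"
  using assms
proof (induction U rule: finite_psubset_induct)
  case (psubset U)
  show ?case
  proof (cases "irreducibly_joined E U v w")
    case False
    then obtain A where "A \<subset> U" "v \<in> A" "w \<in> A" "joined E A v w"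
      using psubset.prems unfolding irreducibly_joined_def by blast
    with psubset.IH show ?thesis
      by (meson order_trans psubset_imp_subset)
  qed blast
qed

text \<open>
  Together with \<open>v\<close>, the component of \<open>w\<close> after the removal of \<open>v\<close> can be entered from the rest only
  at \<open>v\<close>. By retraction it joins \<open>v\<close> to \<open>w\<close>, so by minimality nothing else remains.
\<close>

lemma irreducible_connected_minus:
  assumes "sym E" "irreducibly_joined E U v w" "v \<noteq> w"
    and "a \<in> U - {v}"
  shows "(w, a) \<in> (Restr E (U - {v}))\<^sup>*"
proof -
  define A where "A = {x \<in> U - {v}. (w, x) \<in> (Restr E (U - {v}))\<^sup>*}"
  have step: "y \<in> A" if "x \<in> A" "(x, y) \<in> E" "y \<in> U" "y \<noteq> v" for x y
    using that unfolding A_def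
    by (auto intro!: rtrancl_into_rtrancl[of w x])
  have "joined E (insert v A) v w"
  proof (rule joined_retract[where U = U and c = v])
    fix x y
    assume "(x, y) \<in> Restr E U - {(v, w), (w, v)}" "x \<in> insert v A" "y \<notin> insert v A"
    then show "x = v"
      using step[of x y] by auto
  qed (use assms in \<open>auto simp: irreducibly_joined_def A_def\<close>)
  then have "insert v A = U"
    using assms(2,3) unfolding irreducibly_joined_def A_def by auto
  with assms(4) show ?thesis
    by (auto simp: A_def)
qed

text \<open>
  Let \<open>ab\<close> be different from \<open>vw\<close>. If the edge \<open>ab\<close> were the only connection of \<open>a\<close> and \<open>b\<close>, its deletion would leave at least one of
  them outside the component of \<open>v\<close>. That component also contains \<open>w\<close>, and it is left only through \<open>ab\<close>;
  retracting onto it would contradict minimality. For non-adjacent \<open>a\<close> and \<open>b\<close> nothing is deleted,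
  and the claim is that the induced subgraph is connected.
\<close>

lemma irreducible_pairs_joined:
  assumes "sym E" "irreducibly_joined E U v w"
    and ab: "a \<in> U" "b \<in> U" "(a, b) \<in> E \<longleftrightarrow> (v, w) \<in> E"
  shows "joined E U a b"
proof (cases "{a, b} = {v, w}")
  case True
  then show ?thesis
    using assms joined_sym[OF assms(1)] by (auto simp: irreducibly_joined_def doubleton_eq_iff)
next
  case False
  have U: "v \<in> U" "w \<in> U" "joined E U v w"
    using assms(2) by (auto simp: irreducibly_joined_def)
  let ?R = "Restr E U - {(a, b), (b, a)}"
  have symR: "sym (?R\<^sup>*)"
    using assms(1) by (intro sym_rtrancl) (auto simp: sym_def)
  define A where "A = {x \<in> U. (v, x) \<in> ?R\<^sup>*}"
  have step: "y \<in> A" if "x \<in> A" "(x, y) \<in> ?R" for x y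
    using that unfolding A_def by (auto intro: rtrancl_into_rtrancl)
  have "w \<in> A"
  proof (cases "(v, w) \<in> E")
    case True
    then show ?thesis
      using False U step[of v w] unfolding A_def by (auto simp: doubleton_eq_iff)
  next
    case nadj: False
    then have "Restr E U - {(v, w), (w, v)} \<subseteq> ?R"
      using ab(3) assms(1) by (auto simp: sym_def)
    then have "(v, w) \<in> ?R\<^sup>*"
      using U(3) rtrancl_mono unfolding joined_def by blast
    with U(2) show ?thesis
      by (simp add: A_def)
  qed
  moreover have "v \<in> A"
    using U(1) by (simp add: A_def)
  moreover have "joined E A v w" if "a \<notin> A \<or> b \<notin> A"
  (* A is closed under all edges except ab, so it can be left only from whichever of a and b it
     contains. If it contains neither, it is not left at all and the value of c does not matter. *)
  proof (rule joined_retract[where c = "if a \<in> A then a else b"])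
    fix x y
    assume xy: "(x, y) \<in> Restr E U - {(v, w), (w, v)}" "x \<in> A" "y \<notin> A"
    then have "(x, y) = (a, b) \<or> (x, y) = (b, a)"
      using step[of x y] by blast
    with xy show "x = (if a \<in> A then a else b)"
      by auto
  qed (use assms(1) U(3) \<open>w \<in> A\<close> \<open>v \<in> A\<close> in auto)
  moreover have "A \<subseteq> U"
    by (auto simp: A_def)
  ultimately have "a \<in> A \<and> b \<in> A"
    using assms(2) ab unfolding irreducibly_joined_def by blast
  then have "(a, v) \<in> ?R\<^sup>*" "(v, b) \<in> ?R\<^sup>*"
    using symR by (auto simp: A_def sym_def)
  then show ?thesis
    unfolding joined_def by (rule rtrancl_trans)
qed

text \<open>
  In an irreducible subset \<open>A\<close> of \<open>U\<close> all pairs that are adjacent exactly when \<open>v\<close> and \<open>w\<close> are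
  satisfy \<open>joined\<close>, which is an invariant property, so \<open>A\<close> has a counterpart through \<open>\<pi> v\<close> and
  \<open>\<pi> w\<close> provided that it is small enough for Kelly's lemma. Only the case that \<open>A\<close> is the entire vertex
  set remains; there the connectedness of the two cards is enough.
\<close>

lemma joined_transfer:
  assumes "finite V" "sym E" "sym E'" "hypomorphic \<pi> V E V' E'"
    and vw: "v \<in> V" "w \<in> V" "v \<noteq> w" "isomorphic (V - {v, w}) E (V' - {\<pi> v, \<pi> w}) E'"
    and "V - {v, w} \<noteq> {}"
    and adj: "(v, w) \<in> E \<longleftrightarrow> (\<pi> v, \<pi> w) \<in> E'"
    and U: "U \<subseteq> V" "v \<in> U" "w \<in> U" "joined E U v w"
  shows "\<exists>U'\<subseteq>V'. \<pi> v \<in> U' \<and> \<pi> w \<in> U' \<and> joined E' U' (\<pi> v) (\<pi> w) \<and> card U' \<le> card U"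
proof -
  have bij: "bij_betw \<pi> V V'"
    and iso: "\<And>x. x \<in> V \<Longrightarrow> isomorphic (V - {x}) E (V' - {\<pi> x}) E'"
    using assms(4) by (auto simp: hypomorphic_def)
  have mem': "\<pi> v \<in> V'" "\<pi> w \<in> V'" "\<pi> v \<noteq> \<pi> w"
    using bij vw bij_betwE bij_betw_imp_inj_on inj_on_eq_iff by metis+
  obtain A where A: "A \<subseteq> U" "irreducibly_joined E A v w"
    using joined_imp_irreducible U assms(1) finite_subset by metis
  have AU: "card A \<le> card U"
    using A(1) U(1) assms(1) by (meson card_mono finite_subset)
  have Ain: "v \<in> A" "w \<in> A"
    using A(2) by (auto simp: irreducibly_joined_def)
  show ?thesis
  proof (cases "card A < card V")
    case True
    (* P for the first graph and P' for the second: the pairs with the adjacency of v and w are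
       joined. Both refer to the same truth value, so that they are the same property. *)
    define P where "P W \<longleftrightarrow> (\<forall>a\<in>W. \<forall>b\<in>W. ((a, b) \<in> E \<longleftrightarrow> (v, w) \<in> E) \<longrightarrow> joined E W a b)" for W
    define P' where "P' W \<longleftrightarrow> (\<forall>a\<in>W. \<forall>b\<in>W. ((a, b) \<in> E' \<longleftrightarrow> (v, w) \<in> E) \<longrightarrow> joined E' W a b)" for W
    have "same_property P V E P' V' E'"
      unfolding same_property_def
    proof (intro allI impI iffI)
      fix W W' assume iso: "isomorphic W E W' E'"
      show "P' W'" if "P W"
        using all_pairs_joined_iso[OF iso] that unfolding P_def P'_def .
      show "P W" if "P' W'"
        using all_pairs_joined_iso[OF isomorphic_sym[OF iso]] that unfolding P_def P'_def .
    qed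
    moreover have "P A"
      unfolding P_def using irreducible_pairs_joined[OF assms(2) A(2)] by blast
    ultimately obtain W' where W': "W' \<subseteq> V'" "card W' = card A" "\<pi> v \<in> W'" "\<pi> w \<in> W'" "P' W'"
      using subset_through_transfer[OF assms(1,4) _ vw _ True, of P P'] A(1) U(1) Ain by blast
    have "joined E' W' (\<pi> v) (\<pi> w)"
      using W' adj unfolding P'_def by blast
    with W'(1-4) AU show ?thesis
      by (intro exI[of _ W']) simp
  next
    case False
    then have AV: "A = V"
      using card_seteq[OF assms(1), of A] A(1) U(1) by simp
    obtain g1 where g1: "iso_on g1 (V - {v}) E (V' - {\<pi> v}) E'"
      using iso[OF vw(1)] by (auto simp: isomorphic_def)
    obtain g2 where g2: "iso_on g2 (V - {w}) E (V' - {\<pi> w}) E'"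
      using iso[OF vw(2)] by (auto simp: isomorphic_def)
    have "V' - {\<pi> v, \<pi> w} \<noteq> {}"
      using assms(9) vw(4) by (auto simp: isomorphic_def iso_on_def bij_betw_def)
    then obtain z where z: "z \<in> V' - {\<pi> v, \<pi> w}" by blast
    have conn: "(x, y) \<in> (Restr E' (V' - {\<pi> s}))\<^sup>*"
      if st: "irreducibly_joined E V s t" "s \<noteq> t" and g: "iso_on g (V - {s}) E (V' - {\<pi> s}) E'"
        and xy: "x \<in> V' - {\<pi> s}" "y \<in> V' - {\<pi> s}" for s t g x y
    proof -
      obtain a b where ab: "a \<in> V - {s}" "x = g a" "b \<in> V - {s}" "y = g b"
        using xy unfolding iso_on_image[OF g, symmetric] by (elim imageE) simp
      have "sym ((Restr E (V - {s}))\<^sup>*)"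
        using assms(2) by (intro sym_rtrancl) (auto simp: sym_def)
      then have "(a, b) \<in> (Restr E (V - {s}))\<^sup>*"
        using irreducible_connected_minus[OF assms(2) st] ab(1,3)
        by (meson rtrancl_trans symE)
      then show ?thesis
        using iso_on_rtrancl[OF g] ab(2,4) by blast
    qed
    (* A path from z to either vertex inside the card that omits the other one cannot use the edge
       between the two. *)
    let ?R = "Restr E' V' - {(\<pi> v, \<pi> w), (\<pi> w, \<pi> v)}"
    have "Restr E' (V' - {\<pi> v}) \<subseteq> ?R" "Restr E' (V' - {\<pi> w}) \<subseteq> ?R"
      by auto
    moreover have "(z, \<pi> w) \<in> (Restr E' (V' - {\<pi> v}))\<^sup>*"
      using conn[OF _ vw(3) g1] A(2) AV z mem' by auto
    moreover have "(\<pi> v, z) \<in> (Restr E' (V' - {\<pi> w}))\<^sup>*"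
      using conn[OF _ vw(3)[symmetric] g2] irreducibly_joined_sym[OF assms(2) A(2)] AV z mem' by auto
    ultimately have "(\<pi> v, \<pi> w) \<in> ?R\<^sup>*"
      using rtrancl_mono by (meson rtrancl_trans subsetD)
    then have "joined E' V' (\<pi> v) (\<pi> w)"
      by (simp add: joined_def)
    moreover have "card V' \<le> card U"
      using AU AV bij bij_betw_same_card by fastforce
    ultimately show ?thesis
      using mem' by blast
  qed
qed

section \<open>The distance as the size of a smallest connecting set\<close>

text \<open>
  A path with \<open>n\<close> vertices has \<open>n - 1\<close> edges, and the infimum of the empty set is \<open>\<infinity>\<close>; so this is
  the distance of \<open>v\<close> and \<open>w\<close> when a possible edge between them is ignored.
\<close>

definition join_cost :: "'a set \<Rightarrow> 'a rel \<Rightarrow> 'a \<Rightarrow> 'a \<Rightarrow> ereal" where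
  "join_cost V E v w = (INF U\<in>{U. U \<subseteq> V \<and> v \<in> U \<and> w \<in> U \<and> joined E U v w}. ereal (real (card U) - 1))"

lemma join_cost_le:
  assumes "\<And>U. U \<subseteq> V \<Longrightarrow> v \<in> U \<Longrightarrow> w \<in> U \<Longrightarrow> joined E U v w \<Longrightarrow>
    \<exists>U'\<subseteq>V'. v' \<in> U' \<and> w' \<in> U' \<and> joined E' U' v' w' \<and> card U' \<le> card U"
  shows "join_cost V' E' v' w' \<le> join_cost V E v w"
  unfolding join_cost_def
proof (rule INF_mono)
  fix U assume "U \<in> {U. U \<subseteq> V \<and> v \<in> U \<and> w \<in> U \<and> joined E U v w}"
  then have "U \<subseteq> V" "v \<in> U" "w \<in> U" "joined E U v w"
    by simp_all
  from assms[OF this] obtain U' where "U' \<subseteq> V'" "v' \<in> U'" "w' \<in> U'" "joined E' U' v' w'" "card U' \<le> card U"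
    by (elim exE conjE)
  then show "\<exists>U'\<in>{U. U \<subseteq> V' \<and> v' \<in> U \<and> w' \<in> U \<and> joined E' U v' w'}.
      ereal (real (card U') - 1) \<le> ereal (real (card U) - 1)"
    by (intro bexI[of _ U']) auto
qed

lemma join_cost_hypomorphic:
  assumes "finite V" "sym E" "sym E'" "irrefl E" "irrefl E'" "hypomorphic \<pi> V E V' E'"
    and vw: "v \<in> V" "w \<in> V" "v \<noteq> w" "isomorphic (V - {v, w}) E (V' - {\<pi> v, \<pi> w}) E'"
    and ne: "V - {v, w} \<noteq> {}"
  shows "(v, w) \<in> E \<longleftrightarrow> (\<pi> v, \<pi> w) \<in> E'" and "join_cost V E v w = join_cost V' E' (\<pi> v) (\<pi> w)"
proof -
  let ?\<rho> = "inv_into V \<pi>"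
  have bij: "bij_betw \<pi> V V'"
    using assms(6) by (simp add: hypomorphic_def)
  then have inv: "?\<rho> (\<pi> v) = v" "?\<rho> (\<pi> w) = w"
    using vw by (simp_all add: bij_betw_inv_into_left)
  have mem': "\<pi> v \<in> V'" "\<pi> w \<in> V'" "\<pi> v \<noteq> \<pi> w"
    using bij vw by (auto simp: bij_betw_def inj_on_eq_iff)
  have fin': "finite V'"
    using bij assms(1) bij_betw_finite by blast
  have hyp': "hypomorphic ?\<rho> V' E' V E"
    by (rule hypomorphic_sym[OF assms(6)])
  have iso': "isomorphic (V' - {\<pi> v, \<pi> w}) E' (V - {?\<rho> (\<pi> v), ?\<rho> (\<pi> w)}) E"
    unfolding inv by (rule isomorphic_sym[OF vw(4)])
  have ne': "V' - {\<pi> v, \<pi> w} \<noteq> {}"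
    using ne vw(4) unfolding isomorphic_def iso_on_def bij_betw_def by blast
  show adj: "(v, w) \<in> E \<longleftrightarrow> (\<pi> v, \<pi> w) \<in> E'"
    using adjacent_transfer[OF assms(1,6,3,5) vw ne]
      adjacent_transfer[OF fin' hyp' assms(2,4) mem' iso' ne']
    unfolding inv by blast
  show "join_cost V E v w = join_cost V' E' (\<pi> v) (\<pi> w)"
  proof (rule antisym)
    show "join_cost V' E' (\<pi> v) (\<pi> w) \<le> join_cost V E v w"
      by (rule join_cost_le) (rule joined_transfer[OF assms(1-3,6) vw ne adj])
    have adj': "(\<pi> v, \<pi> w) \<in> E' \<longleftrightarrow> (?\<rho> (\<pi> v), ?\<rho> (\<pi> w)) \<in> E"
      unfolding inv using adj by blast
    show "join_cost V E v w \<le> join_cost V' E' (\<pi> v) (\<pi> w)"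
      using joined_transfer[OF fin' assms(3,2) hyp' mem' iso' ne' adj']
      unfolding inv by (intro join_cost_le)
  qed
qed

lemma join_cost_iso_le:
  assumes h: "iso_on h V E V' E'"
  shows "join_cost V' E' (h v) (h w) \<le> join_cost V E v w"
proof (rule join_cost_le)
  fix U assume U: "U \<subseteq> V" "v \<in> U" "w \<in> U" "joined E U v w"
  have fin: "card (h ` U) = card U"
    using h U(1) unfolding iso_on_def by (meson bij_betw_imp_inj_on card_image inj_on_subset)
  show "\<exists>U'\<subseteq>V'. h v \<in> U' \<and> h w \<in> U' \<and> joined E' U' (h v) (h w) \<and> card U' \<le> card U"
    using U fin iso_on_image[OF h] iso_on_joined[OF iso_on_subset[OF h U(1)] U(2-4)]
    by (intro exI[of _ "h ` U"]) auto
qed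

lemma join_cost_iso:
  assumes h: "iso_on h V E V' E'" and "v \<in> V" "w \<in> V"
  shows "join_cost V' E' (h v) (h w) = join_cost V E v w"
proof (rule antisym[OF join_cost_iso_le[OF h]])
  have "inv_into V h (h v) = v" "inv_into V h (h w) = w"
    using assms by (auto simp: iso_on_def bij_betw_inv_into_left)
  then show "join_cost V E v w \<le> join_cost V' E' (h v) (h w)"
    using join_cost_iso_le[OF iso_on_inv[OF h], of "h v" "h w"] by simp
qed

text \<open>
  The vertices of a walk form a connecting set with at most one element more than the walk has arcs.
  Conversely a connecting set contains a path without repeated vertices, which has fewer arcs than the
  set has elements.
\<close>

lemma (in fin_digraph) unit_cost_eq_join_cost:
  assumes "(x, y) \<notin> arcs_ends G" "(y, x) \<notin> arcs_ends G"
  shows "\<mu> (\<lambda>_. 1) x y = join_cost (verts G) (arcs_ends G) x y"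
proof (rule antisym)
  have joined_iff: "joined (arcs_ends G) U x y \<longleftrightarrow> (x, y) \<in> (Restr (arcs_ends G) U)\<^sup>*" for U
  proof -
    have "Restr (arcs_ends G) U - {(x, y), (y, x)} = Restr (arcs_ends G) U"
      using assms by blast
    then show ?thesis
      by (simp only: joined_def)
  qed
  have cost: "awalk_cost (\<lambda>_. 1) p = real (length p)" for p
    by (induction p) simp_all
  show "join_cost (verts G) (arcs_ends G) x y \<le> \<mu> (\<lambda>_. 1) x y"
    unfolding \<mu>_def join_cost_def
  proof (rule INF_mono)
    fix p assume "p \<in> {p. awalk x p y}"
    then have p: "awalk x p y" by simp
    let ?U = "set (awalk_verts x p)"
    have "(x, y) \<in> (Restr (arcs_ends G) ?U)\<^sup>*"
      using p
    proof (induction p arbitrary: x)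
      case Nil
      then show ?case by (simp add: awalk_Nil_iff)
    next
      case (Cons e p)
      let ?W = "set (awalk_verts x (e # p))"
      have e: "e \<in> arcs G" "x = tail G e" "awalk (head G e) p y"
        using Cons.prems by (auto simp: awalk_Cons_iff)
      have "(x, head G e) \<in> Restr (arcs_ends G) ?W"
        using e hd_in_awalk_verts(1)[OF e(3)] by (auto intro: in_arcs_imp_in_arcs_ends)
      moreover have "(head G e, y) \<in> (Restr (arcs_ends G) ?W)\<^sup>*"
        by (rule subsetD[OF rtrancl_mono Cons.IH[OF e(3)]]) auto
      ultimately show ?case
        by (rule converse_rtrancl_into_rtrancl)
    qed
    moreover have "card ?U \<le> length p + 1"
      using card_length[of "awalk_verts x p"] by (simp add: length_awalk_verts)
    moreover have "x \<in> ?U"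
      by (rule hd_in_awalk_verts(1)[OF p])
    moreover have "y \<in> ?U"
      using p last_in_set[of "awalk_verts x p"] by (elim awalkE) simp
    moreover have "?U \<subseteq> verts G"
      using p by (rule awalkE)
    ultimately show "\<exists>U\<in>{U. U \<subseteq> verts G \<and> x \<in> U \<and> y \<in> U \<and> joined (arcs_ends G) U x y}.
        ereal (real (card U) - 1) \<le> ereal (awalk_cost (\<lambda>_. 1) p)"
      by (intro bexI[of _ ?U]) (auto simp: joined_iff cost)
  qed
  show "\<mu> (\<lambda>_. 1) x y \<le> join_cost (verts G) (arcs_ends G) x y"
    unfolding join_cost_def
  proof (rule INF_greatest)
    fix U assume "U \<in> {U. U \<subseteq> verts G \<and> x \<in> U \<and> y \<in> U \<and> joined (arcs_ends G) U x y}"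
    then have U: "U \<subseteq> verts G" "x \<in> U" "y \<in> U" "(x, y) \<in> (Restr (arcs_ends G) U)\<^sup>*"
      by (simp_all add: joined_iff)
    interpret D: fin_digraph "G \<restriction> U"
      using U(1) by unfold_locales (auto intro: finite_subset)
    have "arcs_ends (G \<restriction> U) = Restr (arcs_ends G) U"
      by (auto simp: arcs_ends_conv)
    with U have "x \<rightarrow>\<^sup>*\<^bsub>G \<restriction> U\<^esub> y"
      by (simp add: D.reachable_conv')
    then obtain p where p: "D.apath x p y"
      using D.reachable_apath by blast
    then have "D.awalk x p y"
      by (simp add: D.apath_def)
    then have "awalk x p y"
      using U(1) by (auto simp: D.awalk_def awalk_def compatible_cas[OF compatible_induce_subgraph])
    then have "\<mu> (\<lambda>_. 1) x y \<le> ereal (real (length p))"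
      using min_cost_le_walk_cost[of x p y "\<lambda>_. 1"] by (simp add: cost)
    also have "\<dots> \<le> ereal (real (card U) - 1)"
      using D.length_apath_less[OF p] by simp
    finally show "\<mu> (\<lambda>_. 1) x y \<le> ereal (real (card U) - 1)" .
  qed
qed

text \<open>
  Adding to \<open>H\<close> two vertices with the neighborhoods of \<open>v\<close> and \<open>w\<close> rebuilds the graph up to the edge
  between \<open>v\<close> and \<open>w\<close>. As \<open>f\<close> may be any isomorphism onto \<open>H\<close>, distances in a graph that merely
  contains a copy of \<open>H\<close> are covered as well.
\<close>

lemma dist_within_eq_join_cost:
  fixes H :: "('a, 'b) pre_digraph"
  assumes "graph H" "sym E" "irrefl E" "v \<in> V" "w \<in> V" "v \<noteq> w"
    and f: "iso_on f (V - {v, w}) E (verts H) (arcs_ends H)"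
  shows "dist_within H (f ` {x \<in> V - {v, w}. (v, x) \<in> E}) (f ` {x \<in> V - {v, w}. (w, x) \<in> E})
    = join_cost V E v w"
proof -
  interpret H: graph H by fact
  define S where "S = f ` {x \<in> V - {v, w}. (v, x) \<in> E}"
  define T where "T = f ` {x \<in> V - {v, w}. (w, x) \<in> E}"
  let ?X = "extend H S T" and ?F = "E - {(v, w), (w, v)}"
  let ?h = "(Old \<circ> f)(v := New_x, w := New_y)"
  have ST: "S \<subseteq> verts H" "T \<subseteq> verts H"
    using iso_on_image[OF f] by (auto simp: S_def T_def)
  have arcs: "parcs ?X = {(Old a, Old b) | a b. (a, b) \<in> arcs_ends H} \<union>
      {(New_x, Old a) | a. a \<in> S} \<union> {(Old a, New_x) | a. a \<in> S} \<union>
      {(New_y, Old a) | a. a \<in> T} \<union> {(Old a, New_y) | a. a \<in> T}"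
    by (auto simp: extend_def symcl_def)
  have verts: "pverts ?X = Old ` verts H \<union> {New_x, New_y}"
    by (simp add: extend_def)
  have nbrs: "{y \<in> pverts ?X - {New_x, New_y}. (New_x, y) \<in> parcs ?X} = Old ` S"
    "{y \<in> pverts ?X - {New_x, New_y}. (New_y, y) \<in> parcs ?X} = Old ` T"
    "{x \<in> V - {v, w}. (v, x) \<in> ?F} = {x \<in> V - {v, w}. (v, x) \<in> E}"
    "{x \<in> V - {v, w}. (w, x) \<in> ?F} = {x \<in> V - {v, w}. (w, x) \<in> E}"
    using ST by (auto simp: arcs verts)
  have fin: "finite (pverts ?X)"
    by (simp add: verts)
  have "parcs ?X \<subseteq> pverts ?X \<times> pverts ?X"
    using ST H.adj_in_verts by (auto simp: arcs verts)
  then interpret X: fin_digraph "with_proj ?X"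
    using fin by unfold_locales (auto intro: finite_subset)
  have "iso_on Old (verts H) (arcs_ends H) (pverts ?X - {New_x, New_y}) (parcs ?X)"
    by (auto simp: iso_on_def bij_betw_def inj_on_def verts arcs)
  from iso_on_comp[OF f this]
  have "iso_on (Old \<circ> f) (V - {v, w}) ?F (pverts ?X - {New_x, New_y}) (parcs ?X)"
    by (auto simp: iso_on_def)
  then have "iso_on ?h V ?F (pverts ?X) (parcs ?X)"
  proof (rule iso_on_add_two)
    show "sym (parcs ?X)"
      using H.sym_arcs by (auto simp: sym_def arcs symmetric_def)
    show "irrefl (parcs ?X)"
      using H.adj_not_same by (auto simp: irrefl_def arcs)
    show "(Old \<circ> f) ` {x \<in> V - {v, w}. (v, x) \<in> ?F} = {y \<in> pverts ?X - {New_x, New_y}. (New_x, y) \<in> parcs ?X}"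
      unfolding nbrs unfolding S_def image_comp ..
    show "(Old \<circ> f) ` {x \<in> V - {v, w}. (w, x) \<in> ?F} = {y \<in> pverts ?X - {New_x, New_y}. (New_y, y) \<in> parcs ?X}"
      unfolding nbrs unfolding T_def image_comp ..
  qed (use assms in \<open>auto simp: arcs verts sym_def irrefl_def\<close>)
  from join_cost_iso[OF this assms(4,5)]
  have "join_cost (pverts ?X) (parcs ?X) New_x New_y = join_cost V ?F v w"
    using assms(6) by simp
  also have "\<dots> = join_cost V E v w"
    by (simp only: join_cost_def joined_remove_edge)
  finally show ?thesis
    using X.unit_cost_eq_join_cost[of New_x New_y]
    unfolding dist_within_def S_def[symmetric] T_def[symmetric] by (simp add: arcs)
qed

section \<open>Decks of digraphs and hypomorphic relations\<close>

lemma iso_on_Restr: "iso_on f X (Restr E X) Y (Restr F Y) \<longleftrightarrow> iso_on f X E Y F"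
  unfolding iso_on_def by (auto dest: bij_betwE)

lemma iso_on_Restr_right: "iso_on f X E Y (Restr F Y) \<longleftrightarrow> iso_on f X E Y F"
  unfolding iso_on_def by (auto dest: bij_betwE)

text \<open>
  Without parallel arcs an isomorphism is determined by its map on the vertices. The image is the
  given graph itself and not only an isomorphic one, as is required for automorphisms.
\<close>

lemma iso_on_imp_digraph_isomorphism:
  assumes "graph G" "graph G'" and f: "iso_on f (verts G) (arcs_ends G) (verts G') (arcs_ends G')"
  shows "\<exists>h. pre_digraph.digraph_isomorphism G h \<and> iso_verts h = f \<and> app_iso h G = G'"
proof -
  interpret G: graph G by fact
  interpret G': graph G' by fact
  have inj: "inj_on f (verts G)" and img: "f ` verts G = verts G'"
    using f by (auto simp: iso_on_def bij_betw_def)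
  have edge: "(f a, f b) \<in> arcs_ends G' \<longleftrightarrow> (a, b) \<in> arcs_ends G" if "a \<in> verts G" "b \<in> verts G" for a b
    using f that by (simp add: iso_on_def)
  have "\<forall>e\<in>arcs G. \<exists>e'. e' \<in> arcs G' \<and> tail G' e' = f (tail G e) \<and> head G' e' = f (head G e)"
  proof
    fix e assume e: "e \<in> arcs G"
    then have "(f (tail G e), f (head G e)) \<in> arcs_ends G'"
      using edge by (simp add: G.in_arcs_imp_in_arcs_ends)
    then show "\<exists>e'. e' \<in> arcs G' \<and> tail G' e' = f (tail G e) \<and> head G' e' = f (head G e)"
      by (auto simp: arcs_ends_conv)
  qed
  from bchoice[OF this] obtain g where g: "\<And>e. e \<in> arcs G \<Longrightarrow> g e \<in> arcs G'"
    "\<And>e. e \<in> arcs G \<Longrightarrow> tail G' (g e) = f (tail G e)" "\<And>e. e \<in> arcs G \<Longrightarrow> head G' (g e) = f (head G e)"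
    by blast
  let ?h = "\<lparr>iso_verts = f, iso_arcs = g, iso_head = head G', iso_tail = tail G'\<rparr>"
  have "inj_on g (arcs G)"
  proof (rule inj_onI)
    fix a b assume ab: "a \<in> arcs G" "b \<in> arcs G" "g a = g b"
    then have "f (tail G a) = f (tail G b)" "f (head G a) = f (head G b)"
      using g by metis+
    then have "arc_to_ends G a = arc_to_ends G b"
      using ab(1,2) inj by (simp add: arc_to_ends_def inj_on_eq_iff)
    then show "a = b"
      using ab G.no_multi_arcs by blast
  qed
  then have "G.digraph_isomorphism ?h"
    using g inj by (simp add: G.digraph_isomorphism_def G.wf_digraph)
  moreover have "g ` arcs G = arcs G'"
  proof (intro equalityI subsetI)
    fix e' assume e': "e' \<in> arcs G'"
    then have "tail G' e' \<in> f ` verts G" "head G' e' \<in> f ` verts G"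
      unfolding img by simp_all
    then obtain a b where ab: "a \<in> verts G" "b \<in> verts G" "tail G' e' = f a" "head G' e' = f b"
      by (elim imageE)
    then have "(a, b) \<in> arcs_ends G"
      using edge[of a b] G'.in_arcs_imp_in_arcs_ends[OF e'] by simp
    then obtain e where e: "e \<in> arcs G" "tail G e = a" "head G e = b"
      by (auto simp: arcs_ends_conv)
    have "g e = e'"
      using e e' g ab by (intro G'.no_multi_arcs) (auto simp: arc_to_ends_def)
    with e(1) show "e' \<in> g ` arcs G" by blast
  qed (use g in auto)
  then have "app_iso ?h G = G'"
    using img by (simp add: app_iso_def)
  ultimately show ?thesis
    by (intro exI[of _ ?h]) simp
qed

lemma digraph_isomorphism_imp_iso_on:
  assumes h: "pre_digraph.digraph_isomorphism G h"
  shows "iso_on (iso_verts h) (verts G) (arcs_ends G) (verts (app_iso h G)) (arcs_ends (app_iso h G))"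
proof -
  interpret wf_digraph G
    using h by (simp add: pre_digraph.digraph_isomorphism_def)
  have inj: "inj_on (iso_verts h) (verts G)"
    by (rule digraph_isomorphism_inj_on_verts[OF h])
  have ends: "arcs_ends (app_iso h G) = (\<lambda>e. (iso_verts h (tail G e), iso_verts h (head G e))) ` arcs G"
    by (force simp: arcs_ends_conv iso_verts_tail[OF h] iso_verts_head[OF h])
  have "(iso_verts h a, iso_verts h b) \<in> arcs_ends (app_iso h G) \<longleftrightarrow> (a, b) \<in> arcs_ends G"
    if ab: "a \<in> verts G" "b \<in> verts G" for a b
  proof -
    have "(iso_verts h a, iso_verts h b) = (iso_verts h (tail G e), iso_verts h (head G e)) \<longleftrightarrow>
        (a, b) = (tail G e, head G e)" if "e \<in> arcs G" for e
      using ab that by (simp add: inj_on_eq_iff[OF inj])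
    then show ?thesis
      unfolding ends arcs_ends_conv[of G] image_iff by (intro bex_cong refl)
  qed
  then show ?thesis
    using inj by (auto simp: iso_on_def bij_betw_def)
qed

lemma digraph_iso_iff_isomorphic:
  assumes "graph G" "graph G'"
  shows "digraph_iso G G' \<longleftrightarrow> isomorphic (verts G) (arcs_ends G) (verts G') (arcs_ends G')"
proof
  assume "digraph_iso G G'"
  then show "isomorphic (verts G) (arcs_ends G) (verts G') (arcs_ends G')"
    unfolding digraph_iso_def isomorphic_def using digraph_isomorphism_imp_iso_on by blast
next
  assume "isomorphic (verts G) (arcs_ends G) (verts G') (arcs_ends G')"
  then show "digraph_iso G G'"
    unfolding digraph_iso_def isomorphic_def
    using iso_on_imp_digraph_isomorphism[OF assms] by metis
qed

lemma Aut_iff: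
  assumes "graph H"
  shows "\<alpha> \<in> Aut H \<longleftrightarrow> iso_on \<alpha> (verts H) (arcs_ends H) (verts H) (arcs_ends H)"
proof
  assume "\<alpha> \<in> Aut H"
  then show "iso_on \<alpha> (verts H) (arcs_ends H) (verts H) (arcs_ends H)"
    unfolding Aut_def using digraph_isomorphism_imp_iso_on[of H] by fastforce
next
  assume "iso_on \<alpha> (verts H) (arcs_ends H) (verts H) (arcs_ends H)"
  from iso_on_imp_digraph_isomorphism[OF assms assms this] show "\<alpha> \<in> Aut H"
    unfolding Aut_def by blast
qed

lemma arcs_ends_induce: "arcs_ends (G \<restriction> W) = Restr (arcs_ends G) W"
  by (auto simp: arcs_ends_conv)

lemma graph_induce:
  assumes "graph G" "W \<subseteq> verts G"
  shows "graph (G \<restriction> W)"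
proof -
  interpret graph G by fact
  show ?thesis
  proof unfold_locales
    show "finite (verts (G \<restriction> W))"
      using assms(2) by (auto intro: finite_subset)
    show "symmetric (G \<restriction> W)"
      using sym_arcs by (auto simp: symmetric_def arcs_ends_induce sym_def)
  qed (auto simp: no_loops arc_to_ends_def intro!: no_multi_arcs)
qed

lemma del_vert_eq_induce:
  assumes "wf_digraph G"
  shows "pre_digraph.del_vert G x = G \<restriction> (verts G - {x})"
  using assms unfolding pre_digraph.del_vert_def induce_subgraph_def
  by (auto simp: wf_digraph_def)

lemma digraph_iso_induce_iff:
  assumes "graph G" "graph G'" "X \<subseteq> verts G" "Y \<subseteq> verts G'"
  shows "digraph_iso (G \<restriction> X) (G' \<restriction> Y) \<longleftrightarrow> isomorphic X (arcs_ends G) Y (arcs_ends G')"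
  using digraph_iso_iff_isomorphic[OF graph_induce[OF assms(1,3)] graph_induce[OF assms(2,4)]]
  by (simp add: arcs_ends_induce isomorphic_def iso_on_Restr)

text \<open>
  Equality of decks only compares multisets of isomorphism classes; this lemma recovers a matching of
  the cards.
\<close>

lemma image_mset_mset_set_eq_imp_bij:
  assumes "finite A" "finite B" "image_mset f (mset_set A) = image_mset g (mset_set B)"
  shows "\<exists>\<pi>. bij_betw \<pi> A B \<and> (\<forall>x\<in>A. g (\<pi> x) = f x)"
  using assms
proof (induction A arbitrary: B rule: finite_induct)
  case empty
  then have "B = {}"
    by (simp add: mset_set_empty_iff)
  then show ?case
    by (simp add: bij_betw_def)
next
  case (insert a A)
  have "f a \<in># image_mset g (mset_set B)"
    using insert.hyps unfolding insert.prems(2)[symmetric] by simp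
  then obtain b where b: "b \<in> B" "g b = f a"
    using insert.prems(1) by auto
  have "image_mset g (mset_set B) = add_mset (g b) (image_mset g (mset_set (B - {b})))"
    using b(1) insert.prems(1) by (simp add: mset_set.remove)
  then have "image_mset f (mset_set A) = image_mset g (mset_set (B - {b}))"
    using insert.prems(2) insert.hyps b(2) by simp
  with insert.IH insert.prems(1) obtain \<pi> where \<pi>: "bij_betw \<pi> A (B - {b})" "\<forall>x\<in>A. g (\<pi> x) = f x"
    by blast
  have "bij_betw (\<pi>(a := b)) A (B - {b})"
    using \<pi>(1) insert.hyps(2) by (subst bij_betw_cong[of A _ \<pi>]) auto
  then have "bij_betw (\<pi>(a := b)) (A \<union> {a}) (B - {b} \<union> {b})"
    using insert.hyps(2) by (intro bij_betw_combine) (auto simp: bij_betw_def)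
  moreover have "A \<union> {a} = insert a A" "B - {b} \<union> {b} = B"
    using b(1) by auto
  ultimately have "bij_betw (\<pi>(a := b)) (insert a A) B"
    by simp
  moreover have "\<forall>x\<in>insert a A. g ((\<pi>(a := b)) x) = f x"
    using \<pi>(2) insert.hyps(2) b(2) by auto
  ultimately show ?case by blast
qed

lemma deck_eq_imp_hypomorphic:
  assumes G: "graph G" and G': "graph G'" and "deck G = deck G'"
  shows "\<exists>\<pi>. hypomorphic \<pi> (verts G) (arcs_ends G) (verts G') (arcs_ends G')"
proof -
  interpret G: graph G by fact
  interpret G': graph G' by fact
  obtain \<pi> where bij: "bij_betw \<pi> (verts G) (verts G')"
    and cls: "\<And>x. x \<in> verts G \<Longrightarrow> iso_class (G'.del_vert (\<pi> x)) = iso_class (G.del_vert x)"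
    using image_mset_mset_set_eq_imp_bij[OF G.finite_verts G'.finite_verts assms(3)[unfolded deck_def]]
    by blast
  have "isomorphic (verts G - {x}) (arcs_ends G) (verts G' - {\<pi> x}) (arcs_ends G')"
    if x: "x \<in> verts G" for x
  proof -
    have "iso_class (G \<restriction> (verts G - {x})) = iso_class (G' \<restriction> (verts G' - {\<pi> x}))"
      using cls[OF x] by (simp add: del_vert_eq_induce G.wf_digraph G'.wf_digraph)
    then have "digraph_iso (G \<restriction> (verts G - {x})) (G' \<restriction> (verts G' - {\<pi> x}))"
      by (subst (asm) iso_class_eq_iff) (auto intro: graph_induce[OF G] graph_induce[OF G'])
    then show ?thesis
      by (subst (asm) digraph_iso_induce_iff[OF G G']) auto
  qed
  with bij show ?thesis
    unfolding hypomorphic_def by blast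
qed

section \<open>Reconstruction from an anchor that misses two vertices\<close>

theorem lemma5:
  fixes G H :: "('a, 'b) pre_digraph" and v w :: 'a
  assumes "graph G"
    and "v \<in> verts G" and "w \<in> verts G" and "v \<noteq> w"
    and "H = G \<restriction> (verts G - {v, w})"
    and "anchor G H"
    and "distance_specifies_placement H
           (neighborhood G v \<inter> verts H) (neighborhood G w \<inter> verts H)"
  shows "reconstructible G"
  unfolding reconstructible_def
proof (intro allI impI, elim conjE)
  fix K :: "nat pair_pre_digraph"
  assume K: "graph (with_proj K)" and deck: "deck (with_proj K) = deck G"
  note G = assms(1) and v = assms(2) and w = assms(3) and vw = assms(4) and H = assms(5)
  interpret G: graph G by fact
  interpret K: graph "with_proj K" by fact
  let ?V = "verts G" and ?E = "arcs_ends G" and ?V' = "verts (with_proj K)" and ?E' = "arcs_ends (with_proj K)"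
  let ?VH = "?V - {v, w}"
  obtain \<pi> where hyp: "hypomorphic \<pi> ?V ?E ?V' ?E'"
    using deck_eq_imp_hypomorphic[OF G K deck[symmetric]] by blast
  have syms: "sym ?E" "sym ?E'" and irrefls: "irrefl ?E" "irrefl ?E'"
    using G.sym_arcs K.sym_arcs G.adj_not_same K.adj_not_same by (auto simp: symmetric_def irrefl_def)
  have bij: "bij_betw \<pi> ?V ?V'"
    and iso: "\<And>x. x \<in> ?V \<Longrightarrow> isomorphic (?V - {x}) ?E (?V' - {\<pi> x}) ?E'"
    using hyp by (auto simp: hypomorphic_def)
  have mem': "\<pi> v \<in> ?V'" "\<pi> w \<in> ?V'" "\<pi> v \<noteq> \<pi> w"
    using bij v w vw by (auto simp: bij_betw_def inj_on_eq_iff)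
  let ?VH' = "?V' - {\<pi> v, \<pi> w}"
  have H_verts: "verts H = ?VH" and H_arcs: "arcs_ends H = Restr ?E ?VH" and H_graph: "graph H"
    unfolding H by (auto simp: arcs_ends_induce intro: graph_induce[OF G])
  have Aut: "\<alpha> \<in> Aut H \<longleftrightarrow> iso_on \<alpha> ?VH ?E ?VH ?E" for \<alpha>
    by (simp only: Aut_iff[OF H_graph] H_verts H_arcs iso_on_Restr)
  have once: "W = ?VH" if "W \<subseteq> ?V" "isomorphic W ?E ?VH ?E" for W
    using assms(6) that digraph_iso_induce_iff[OF G G that(1), of ?VH]
    unfolding anchor_def H by auto
  have ne: "?VH \<noteq> {}"
    using assms(6) unfolding anchor_def H_verts by blast
  obtain g where g: "iso_on g (?V - {v}) ?E (?V' - {\<pi> v}) ?E'"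
    using iso[OF v] by (auto simp: isomorphic_def)
  obtain k where k: "iso_on k (?V - {w}) ?E (?V' - {\<pi> w}) ?E'"
    using iso[OF w] by (auto simp: isomorphic_def)
  have g0: "g ` ?VH = ?VH'" and k0: "k ` ?VH = ?VH'"
    using anchor_transfer[OF G.finite_verts hyp v w vw once] g k by blast+
  have gH: "iso_on g ?VH ?E ?VH' ?E'" and kH: "iso_on k ?VH ?E ?VH' ?E'"
    using iso_on_subset_to[OF g _ g0] iso_on_subset_to[OF k _ k0] by blast+
  have gw: "g w = \<pi> w"
  proof -
    have "inj_on g (?V - {v})" "g ` (?V - {v}) = ?V' - {\<pi> v}"
      using g by (auto simp: iso_on_def bij_betw_def)
    then have "g w \<in> ?V' - {\<pi> v}" "g w \<notin> g ` ?VH"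
      using w vw by (auto simp: inj_on_def)
    then show ?thesis
      unfolding g0 by blast
  qed
  have kv: "k v = \<pi> v"
  proof -
    have "inj_on k (?V - {w})" "k ` (?V - {w}) = ?V' - {\<pi> w}"
      using k by (auto simp: iso_on_def bij_betw_def)
    then have "k v \<in> ?V' - {\<pi> w}" "k v \<notin> k ` ?VH"
      using v vw by (auto simp: inj_on_def)
    then show ?thesis
      unfolding k0 by blast
  qed
  define S where "S = {x \<in> ?VH. (v, x) \<in> ?E}"
  define T where "T = {x \<in> ?VH. (w, x) \<in> ?E}"
  define S' where "S' = {x \<in> ?VH'. (\<pi> v, x) \<in> ?E'}"
  define T' where "T' = {x \<in> ?VH'. (\<pi> w, x) \<in> ?E'}"
  have kS: "k ` S = S'"
    unfolding S_def S'_def using iso_on_image_nbrs[OF k, of ?VH v] v vw k0 kv by auto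
  have gT: "g ` T = T'"
    unfolding T_def T'_def using iso_on_image_nbrs[OF g, of ?VH w] w vw g0 gw by auto
  let ?gi = "inv_into ?VH g"
  (* Pulled back to H along g, the neighborhoods of v and w in the second graph are the images of S
     under alpha and of T under the identity. *)
  define \<alpha> where "\<alpha> = ?gi \<circ> k"
  have gi: "iso_on ?gi ?VH' ?E' ?VH ?E"
    by (rule iso_on_inv[OF gH])
  have \<alpha>: "iso_on \<alpha> ?VH ?E ?VH ?E"
    unfolding \<alpha>_def by (rule iso_on_comp[OF kH gi])
  have \<alpha>S: "\<alpha> ` S = ?gi ` S'"
    unfolding \<alpha>_def kS[symmetric] by (rule image_comp[symmetric])
  have giT: "?gi ` T' = T"
  proof -
    have "T \<subseteq> ?VH"
      by (auto simp: T_def)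
    then show ?thesis
      unfolding gT[symmetric] using gH
      by (intro bij_betw_inv_into_subset[THEN bij_betw_imp_surj_on]) (auto simp: iso_on_def bij_betw_def)
  qed
  have isoH: "isomorphic ?VH ?E ?VH' ?E'"
    using gH by (auto simp: isomorphic_def)
  note transfer = join_cost_hypomorphic[OF G.finite_verts syms irrefls hyp v w vw isoH ne]
  have "dist_within H (id ` S) (id ` T) = join_cost ?V ?E v w"
    unfolding S_def T_def
    by (rule dist_within_eq_join_cost[OF H_graph syms(1) irrefls(1) v w vw])
      (simp only: H_verts H_arcs iso_on_Restr_right iso_on_id)
  moreover have "dist_within H (?gi ` S') (?gi ` T') = join_cost ?V' ?E' (\<pi> v) (\<pi> w)"
    unfolding S'_def T'_def
    by (rule dist_within_eq_join_cost[OF H_graph syms(2) irrefls(2) mem'])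
      (simp only: H_verts H_arcs iso_on_Restr_right gi)
  ultimately have dist: "dist_within H (\<alpha> ` S) (id ` T) = dist_within H S T"
    using transfer(2) by (simp add: \<alpha>S giT)
  have nbrs: "neighborhood G v \<inter> verts H = S" "neighborhood G w \<inter> verts H = T"
    by (auto simp: neighborhood_def S_def T_def H_verts)
  have "\<alpha> \<in> Aut H" "id \<in> Aut H"
    unfolding Aut using \<alpha> iso_on_id by blast+
  from assms(7)[unfolded distance_specifies_placement_def nbrs, rule_format, OF this dist]
  obtain \<gamma> where "\<gamma> \<in> Aut H" and pair: "{#\<gamma> ` S, \<gamma> ` T#} = {#\<alpha> ` S, id ` T#}"
    by (elim bexE)
  then have \<gamma>: "iso_on \<gamma> ?VH ?E ?VH ?E"
    by (simp only: Aut)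
  define \<phi> where "\<phi> = g \<circ> \<gamma>"
  have \<phi>: "iso_on \<phi> ?VH ?E ?VH' ?E'"
    unfolding \<phi>_def by (rule iso_on_comp[OF \<gamma> gH])
  have g\<alpha>S: "g ` \<alpha> ` S = S'"
    unfolding \<alpha>S using g0 by (intro image_inv_into_cancel) (auto simp: S'_def)
  (* The multisets agree in one of two orders, which decides where v and w are sent. *)
  consider "\<gamma> ` S = \<alpha> ` S" "\<gamma> ` T = T" | "\<gamma> ` S = T" "\<gamma> ` T = \<alpha> ` S"
    using pair by (auto simp: add_eq_conv_ex)
  then have "isomorphic ?V ?E ?V' ?E'"
  proof cases
    case 1
    then have "\<phi> ` S = S'" "\<phi> ` T = T'"
      by (simp_all only: \<phi>_def image_comp[symmetric] g\<alpha>S gT)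
    then have "iso_on (\<phi>(v := \<pi> v, w := \<pi> w)) ?V ?E ?V' ?E'"
      unfolding S_def T_def S'_def T'_def
      by (intro iso_on_add_two[OF \<phi> v w vw mem' syms(1) irrefls(1) syms(2) irrefls(2) transfer(1)])
    then show ?thesis
      unfolding isomorphic_def by blast
  next
    case 2
    have swap: "{\<pi> w, \<pi> v} = {\<pi> v, \<pi> w}"
      by (rule insert_commute)
    have adj: "(v, w) \<in> ?E \<longleftrightarrow> (\<pi> w, \<pi> v) \<in> ?E'"
      using transfer(1) syms(2) by (meson symE)
    have "\<phi> ` S = T'" "\<phi> ` T = S'"
      using 2 by (simp_all only: \<phi>_def image_comp[symmetric] g\<alpha>S gT)
    then have "iso_on (\<phi>(v := \<pi> w, w := \<pi> v)) ?V ?E ?V' ?E'"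
      unfolding S_def T_def S'_def T'_def
      by (intro iso_on_add_two[where v' = "\<pi> w" and w' = "\<pi> v", unfolded swap,
            OF \<phi> v w vw mem'(2,1) mem'(3)[symmetric] syms(1) irrefls(1) syms(2) irrefls(2) adj])
    then show ?thesis
      unfolding isomorphic_def by blast
  qed
  then show "digraph_iso (with_proj K) G"
    using digraph_iso_iff_isomorphic[OF K G] isomorphic_sym by blast
qed

end
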